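(* Let $M$ be a matroid on the finite ground set $[n]=\{1,\ldots,n\}$, and let $I_k$ be the number of independent sets of $M$ of size $k$. Suppose that $M$ satisfies Mason's conjecture, i.e. the sequence $\{I_k\}_{k\ge0}$ is ultra-log-concave. Let $\mathbb{I}$ be an independent set of $M$ chosen uniformly at random from all independent sets of $M$, and let $\lambda=E|\mathbb{I}|$ be its average cardinality. Let $Q$ be a log-concave probability distribution on $\mathbb{N}=\{1,2,\ldots\}$ with $Q(1)>0$ and $\lambda Q(1)^2\ge2Q(2)$. Let $X_1,\ldots,X_n$ be i.i.d. with law $Q$, independent of $\mathbb{I}$, and let $W=\sum_{i\in\mathbb{I}}X_i$ be the random weight of $\mathbb{I}$. Then $$H(W)\le H(C_Q\Pi_\lambda).$$
   Context: A matroid $M$ on $[n]$ is a collection of subsets of $[n]$, called independent sets, such that the empty set is independent, every subset of an independent set is independent, and if $A,B$ are independent with $|A|>|B|$ then some element of $A\setminus B$ can be added to $B$ to give an independent set. A nonnegative sequence $\{I_k\}_{k\ge0}$ is ultra-log-concave if its support is an interval of successive integers and $kI_k^2\ge(k+1)I_{k+1}I_{k-1}$ for all $k\ge1$. $H$ denotes discrete entropy: $H(P)=-\sum_xP(x)\log P(x)$ (natural logarithm, $0\log0=0$), and $H(W)$ is the entropy of the law of $W$. A distribution $P$ on $\mathbb{Z}_+=\{0,1,\ldots\}$ is log-concave if its support is a (possibly infinite) interval of successive integers and $P(x)^2\ge P(x+1)P(x-1)$ for all $x\ge1$; a distribution on $\mathbb{N}$ is regarded as one on $\mathbb{Z}_+$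 with zero mass at $0$. $\Pi_\lambda(x)=e^{-\lambda}\lambda^x/x!$ is the Poisson mass function, and $C_Q\Pi_\lambda(x)=\sum_{y\ge0}\Pi_\lambda(y)Q^{*y}(x)$ is the compound Poisson distribution, where $Q^{*y}$ is the $y$-fold convolution power of $Q$ and $Q^{*0}$ is the point mass at $0$. *)

theory Defs
  imports "HOL-Probability.Probability"
begin

definition matroid :: "'a set \<Rightarrow> 'a set set \<Rightarrow> bool" where
  "matroid E ind \<longleftrightarrow>
     finite E \<and> (\<forall>A\<in>ind. A \<subseteq> E) \<and> {} \<in> ind \<and>
     (\<forall>A B. B \<in> ind \<longrightarrow> A \<subseteq> B \<longrightarrow> A \<in> ind) \<and>
     (\<forall>A\<in>ind. \<forall>B\<in>ind. card A > card B \<longrightarrow> (\<exists>x\<in>A - B. insert x B \<in> ind))"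

definition num_indep :: "'a set set \<Rightarrow> nat \<Rightarrow> nat" where
  "num_indep ind k = card {A \<in> ind. card A = k}"

definition interval_support :: "(nat \<Rightarrow> real) \<Rightarrow> bool" where
  "interval_support f \<longleftrightarrow>
     (\<forall>a b c. a \<le> b \<longrightarrow> b \<le> c \<longrightarrow> f a \<noteq> 0 \<longrightarrow> f c \<noteq> 0 \<longrightarrow> f b \<noteq> 0)"

definition ultra_log_concave :: "(nat \<Rightarrow> real) \<Rightarrow> bool" where
  "ultra_log_concave f \<longleftrightarrow>
     (\<forall>k. 0 \<le> f k) \<and> interval_support f \<and>
     (\<forall>k\<ge>1. real k * (f k)\<^sup>2 \<ge> real (k + 1) * f (k + 1) * f (k - 1))"

definition log_concave :: "nat pmf \<Rightarrow> bool" where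
  "log_concave P \<longleftrightarrow>
     interval_support (pmf P) \<and>
     (\<forall>x\<ge>1. (pmf P x)\<^sup>2 \<ge> pmf P (x + 1) * pmf P (x - 1))"

text \<open>
  Entropy of a probability mass function. All terms are nonnegative because the values of \<open>P\<close>
  lie in \<open>[0, 1]\<close>, so the sum is taken in the extended nonnegative reals and is always defined.
\<close>

definition discrete_entropy :: "(nat \<Rightarrow> real) \<Rightarrow> ennreal" where
  "discrete_entropy P = (\<Sum>x. ennreal (- (P x * ln (P x))))"

text \<open>
  Defined directly, rather than through \<open>poisson_pmf\<close>, because the parameter may be \<open>0\<close>
  (a matroid all of whose elements are loops); then it is the point mass at \<open>0\<close>.
\<close>

definition poisson_mass :: "real \<Rightarrow> nat \<Rightarrow> real" where
  "poisson_mass l x = exp (- l) * l ^ x / fact x"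

definition convolution :: "(nat \<Rightarrow> real) \<Rightarrow> (nat \<Rightarrow> real) \<Rightarrow> nat \<Rightarrow> real" where
  "convolution f g x = (\<Sum>y\<le>x. f y * g (x - y))"

primrec conv_power :: "(nat \<Rightarrow> real) \<Rightarrow> nat \<Rightarrow> nat \<Rightarrow> real" where
  "conv_power f 0 = (\<lambda>x. if x = 0 then 1 else 0)"
| "conv_power f (Suc y) = convolution f (conv_power f y)"

definition compound_poisson :: "nat pmf \<Rightarrow> real \<Rightarrow> nat \<Rightarrow> real" where
  "compound_poisson Q l x = (\<Sum>y. poisson_mass l y * conv_power (pmf Q) y x)"

text \<open>
  Independence of two random elements with values in spaces of different types. The library
  constant \<open>indep_var\<close> forces both value types to coincide; for equal types the definition
  below is exactly its characterization \<open>indep_var_eq\<close>.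
\<close>

definition indep_elements ::
    "'w measure \<Rightarrow> 'a measure \<Rightarrow> ('w \<Rightarrow> 'a) \<Rightarrow> 'b measure \<Rightarrow> ('w \<Rightarrow> 'b) \<Rightarrow> bool" where
  "indep_elements \<Omega> S X T Y \<longleftrightarrow>
     X \<in> measurable \<Omega> S \<and> Y \<in> measurable \<Omega> T \<and>
     prob_space.indep_set \<Omega>
       (sigma_sets (space \<Omega>) {X -` A \<inter> space \<Omega> | A. A \<in> sets S})
       (sigma_sets (space \<Omega>) {Y -` A \<inter> space \<Omega> | A. A \<in> sets T})"

end

theory Submission
  imports Defs
begin

text \<open>
  Only the size \<open>N\<close> of the random independent set matters: the weight \<open>W\<close> is a sum of \<open>N\<close> i.i.d. variables
  with law \<open>Q\<close> (\<open>prob_random_weight\<close>), and Mason's conjecture says that the law of \<open>N\<close> is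
  ultra-log-concave. The statement is thus that, among random sums with ultra-log-concave \<open>N\<close> of mean
  \<open>\<lambda>\<close>, Poisson many summands maximise the entropy (\<open>compound_poisson_max_entropy\<close>).

  Write \<open>R\<close> for the compound Poisson distribution. By Gibbs' inequality the entropy of \<open>W\<close> is at most the
  cross entropy \<open>E (- ln R(W))\<close>, and the entropy of \<open>R\<close> is the same expression with \<open>W\<close> replaced by a
  variable with law \<open>R\<close>. It therefore suffices that \<open>- ln R\<close> is convex and that \<open>W\<close> precedes \<open>R\<close> in the
  convex order.

  For the first, the conditions on \<open>Q\<close> make \<open>R\<close> log-concave (\<open>compound_poisson_log_concave\<close>). This is Hansen's
  theorem on sequences defined by a convolution recursion (\<open>log_concave_of_recursion\<close>), applied to Panjer's
  recursion for compound Poisson probabilities.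

  For the second, ultra-log-concavity of \<open>N\<close> means that its mass function divided by the Poisson one is
  log-concave. The law of \<open>N\<close> thus exceeds the Poisson law exactly on an interval, and as the means agree, \<open>N\<close>
  is smaller in the convex order (\<open>expectation_convex_mono\<close>). This passes from the number of
  summands to the sums, because the expectation of a convex function of \<open>k\<close> i.i.d. nonnegative summands is a
  convex function of \<open>k\<close> (\<open>iid_sum_convex\<close>).
\<close>

section \<open>Log-concave sequences\<close>

text \<open>
  The ratios \<open>f (k + 1) / f k\<close> decrease, stated without division. An interior zero would break the
  chain of local inequalities; the interval support excludes it. The local inequality is required
  only below \<open>j\<close>, so that the lemma can serve inside an induction that is still establishing
  log-concavity.
\<close>

lemma log_concave_cross:
  fixes f :: "nat \<Rightarrow> real"
  assumes nonneg: "\<And>k. 0 \<le> f k"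
    and supp: "interval_support f"
    and lc: "\<And>k. k < j \<Longrightarrow> f k * f (Suc (Suc k)) \<le> (f (Suc k))\<^sup>2"
    and "i \<le> j"
  shows "f i * f (Suc j) \<le> f (Suc i) * f j"
  using \<open>i \<le> j\<close> lc
proof (induction j rule: dec_induct)
  case base
  then show ?case by simp
next
  case (step j)
  show ?case
  proof (cases "f (Suc j) = 0")
    case True
    have "f i = 0 \<or> f (Suc (Suc j)) = 0"
      using supp True step.hyps unfolding interval_support_def
      by (meson le_SucI order.refl)
    then show ?thesis using nonneg by auto
  next
    case False
    then have pos: "f (Suc j) > 0" using nonneg[of "Suc j"] by simp
    have IH: "f i * f (Suc j) \<le> f (Suc i) * f j" using step by simp
    have "f i * f (Suc (Suc j)) * f (Suc j) = (f i * f (Suc j)) * f (Suc (Suc j))" by simp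
    also have "\<dots> \<le> (f (Suc i) * f j) * f (Suc (Suc j))"
      using IH nonneg by (intro mult_right_mono) auto
    also have "\<dots> = f (Suc i) * (f j * f (Suc (Suc j)))" by simp
    also have "\<dots> \<le> f (Suc i) * (f (Suc j))\<^sup>2"
      using step.prems[of j] nonneg by (intro mult_left_mono) auto
    also have "\<dots> = f (Suc i) * f (Suc j) * f (Suc j)" by (simp add: power2_eq_square)
    finally show ?thesis using pos by simp
  qed
qed

text \<open>
  Superlevel sets are intervals: a valley at \<open>b\<close> would need a strict descent before \<open>b\<close> and a strict
  ascent after it, against the decreasing ratios.
\<close>

lemma log_concave_superlevel:
  fixes f :: "nat \<Rightarrow> real"
  assumes nonneg: "\<And>k. 0 \<le> f k"
    and supp: "interval_support f"
    and lc: "\<And>k. f k * f (Suc (Suc k)) \<le> (f (Suc k))\<^sup>2"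
    and ord: "a \<le> b" "b \<le> c" and above: "t < f a" "t < f c"
  shows "t < f b"
proof (rule ccontr)
  assume "\<not> t < f b"
  then have b: "f b \<le> t" by simp
  have "\<exists>i. a \<le> i \<and> i < b \<and> f (Suc i) < f i"
  proof (rule ccontr)
    assume "\<not> ?thesis"
    then have mono: "f i \<le> f (Suc i)" if "a \<le> i" "i < b" for i using that by force
    have "f a \<le> f b"
      using \<open>a \<le> b\<close> mono
    proof (induction b rule: dec_induct)
      case (step m)
      then have "f a \<le> f m" by (auto intro: less_SucI)
      also have "f m \<le> f (Suc m)" using step by auto
      finally show ?case .
    qed simp
    then show False using above b by linarith
  qed
  then obtain i where i: "a \<le> i" "i < b" "f (Suc i) < f i" by blast
  have "\<exists>j. b \<le> j \<and> j < c \<and> f j < f (Suc j)"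
  proof (rule ccontr)
    assume "\<not> ?thesis"
    then have anti: "f (Suc j) \<le> f j" if "b \<le> j" "j < c" for j using that by force
    have "f c \<le> f b"
      using \<open>b \<le> c\<close> anti
    proof (induction c rule: dec_induct)
      case (step m)
      then have "f m \<le> f b" by (auto intro: less_SucI)
      moreover have "f (Suc m) \<le> f m" using step by auto
      ultimately show ?case by simp
    qed simp
    then show False using above b by linarith
  qed
  then obtain j where j: "b \<le> j" "j < c" "f j < f (Suc j)" by blast
  have "f i * f (Suc j) \<le> f (Suc i) * f j"
    using i j by (intro log_concave_cross nonneg supp lc) auto
  moreover have "f (Suc i) * f j \<le> f (Suc i) * f (Suc j)"
    using j nonneg by (intro mult_left_mono) auto
  moreover have "f (Suc i) * f (Suc j) < f i * f (Suc j)"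
    using i j nonneg[of j] by (intro mult_strict_right_mono) auto
  ultimately show False by simp
qed

section \<open>Log-concavity of compound Poisson distributions\<close>

text \<open>
  The difference of the two sides is half of
  \<open>\<Sum>k l. (a k * b l - a l * b k) * (r k * s l - r l * s k)\<close> (the Binet-Cauchy identity), whose two
  factors always have the same sign.
\<close>

lemma sum_prod_difference_nonneg:
  fixes a b r s :: "nat \<Rightarrow> real"
  assumes "\<And>k l. k \<le> l \<Longrightarrow> l \<le> m \<Longrightarrow> a k * b l \<le> a l * b k"
    and "\<And>k l. k \<le> l \<Longrightarrow> l \<le> m \<Longrightarrow> r k * s l \<le> r l * s k"
  shows "(\<Sum>k\<le>m. a k * s k) * (\<Sum>l\<le>m. b l * r l) \<le> (\<Sum>k\<le>m. a k * r k) * (\<Sum>l\<le>m. b l * s l)"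
proof -
  define D where "D k l = (a k * b l - a l * b k) * (r k * s l - r l * s k)" for k l
  have nonneg: "0 \<le> D k l" if "k \<le> m" "l \<le> m" for k l
  proof (cases "k \<le> l")
    case True
    then show ?thesis unfolding D_def using assms[of k l] that by (intro mult_nonpos_nonpos) auto
  next
    case False
    then show ?thesis unfolding D_def using assms[of l k] that by (intro mult_nonneg_nonneg) auto
  qed
  have sw: "(\<Sum>k\<le>m. \<Sum>l\<le>m. f l * g k) = (\<Sum>k\<le>m. f k) * (\<Sum>l\<le>m. g l)"
    and ns: "(\<Sum>k\<le>m. \<Sum>l\<le>m. f k * g l) = (\<Sum>k\<le>m. f k) * (\<Sum>l\<le>m. g l)" for f g :: "nat \<Rightarrow> real"
    by (simp_all add: sum_product) (rule sum.swap)
  have "0 \<le> (\<Sum>k\<le>m. \<Sum>l\<le>m. D k l)"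
    using nonneg by (intro sum_nonneg) auto
  also have "(\<Sum>k\<le>m. \<Sum>l\<le>m. D k l) =
      (\<Sum>k\<le>m. \<Sum>l\<le>m. (a k * r k) * (b l * s l)) - (\<Sum>k\<le>m. \<Sum>l\<le>m. (b l * r l) * (a k * s k))
      - (\<Sum>k\<le>m. \<Sum>l\<le>m. (a l * s l) * (b k * r k)) + (\<Sum>k\<le>m. \<Sum>l\<le>m. (a l * r l) * (b k * s k))"
    unfolding D_def sum_subtractf[symmetric] sum.distrib[symmetric]
    by (intro sum.cong refl) (simp add: algebra_simps)
  also have "\<dots> = 2 * ((\<Sum>k\<le>m. a k * r k) * (\<Sum>l\<le>m. b l * s l)
      - (\<Sum>k\<le>m. a k * s k) * (\<Sum>l\<le>m. b l * r l))"
    unfolding sw ns by (simp add: algebra_simps)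
  finally show ?thesis by (simp only: zero_le_mult_iff) simp
qed

text \<open>
  Hansen's criterion. With \<open>p (-1) = 0\<close> the recursion yields, for every \<open>m\<close>, the identity
  \<open>m (m+2) (p (m+1)\<^sup>2 - p m * p (m+2)) = p (m+1) * (r 0 * p m - p (m+1)) + (A D - B C)\<close>, where
  \<open>A D - B C\<close> is the Binet-Cauchy difference formed from the four sums of the products of
  \<open>p (m - k)\<close> and \<open>p (m - k - 1)\<close> with \<open>r k\<close> and \<open>r (k + 1)\<close>. Log-concavity of \<open>p\<close> up to \<open>m\<close> and
  log-concavity of \<open>r\<close> make both terms nonnegative, which is the induction step. The left factor
  \<open>m\<close> vanishes at \<open>m = 0\<close>; that case is exactly the condition \<open>r 1 \<le> (r 0)\<^sup>2\<close>.
\<close>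

theorem log_concave_of_recursion:
  fixes p r :: "nat \<Rightarrow> real"
  assumes p0: "0 < p 0"
    and rec: "\<And>n. real (Suc n) * p (Suc n) = (\<Sum>k\<le>n. p (n - k) * r k)"
    and r_nonneg: "\<And>k. 0 \<le> r k" and r0: "0 < r 0"
    and r_supp: "interval_support r"
    and r_lc: "\<And>k. r k * r (Suc (Suc k)) \<le> (r (Suc k))\<^sup>2"
    and r1: "r 1 \<le> (r 0)\<^sup>2"
  shows "0 < p n" and "p n * p (Suc (Suc n)) \<le> (p (Suc n))\<^sup>2"
proof -
  show pos: "0 < p n" for n
  proof (induction n rule: less_induct)
    case (less n)
    show ?case
    proof (cases n)
      case (Suc m)
      have "0 \<le> p k" if "k \<le> m" for k
        using less[of k] Suc that by simp
      then have "0 < (\<Sum>k\<le>m. p (m - k) * r k)"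
        using less Suc r_nonneg r0
        by (intro sum_pos2[where i = 0]) auto
      then show ?thesis using rec[of m] Suc by (metis of_nat_0_less_iff zero_less_Suc zero_less_mult_pos)
    qed (use p0 in simp)
  qed
  have p_supp: "interval_support p"
    unfolding interval_support_def using pos less_imp_neq by metis
  have p1: "p 1 = r 0 * p 0" using rec[of 0] by simp
  show "p n * p (Suc (Suc n)) \<le> (p (Suc n))\<^sup>2"
  proof (induction n rule: less_induct)
    case (less m)
    have cross: "p i * p (Suc j) \<le> p (Suc i) * p j" if "i \<le> j" "j \<le> m" for i j
      using that less pos by (intro log_concave_cross p_supp) (auto intro: less_imp_le)
    show ?case
    proof (cases m)
      case 0
      have "2 * p 2 = p 1 * r 0 + p 0 * r 1"
        using rec[of 1] by (simp add: numeral_2_eq_2)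
      then have "2 * (p 0 * p 2) = (p 1)\<^sup>2 + (p 0)\<^sup>2 * r 1"
        unfolding p1 by (simp add: power2_eq_square algebra_simps)
      also have "\<dots> \<le> (p 1)\<^sup>2 + (p 0)\<^sup>2 * (r 0)\<^sup>2"
        using r1 by (intro add_left_mono mult_left_mono) auto
      also have "\<dots> = 2 * (p 1)\<^sup>2" unfolding p1 by (simp add: power_mult_distrib)
      finally show ?thesis using 0 by (simp add: numeral_2_eq_2)
    next
      case (Suc m')
      \<comment> \<open>the sequence \<open>p (m - k - 1)\<close> with the convention \<open>p (-1) = 0\<close>\<close>
      define b where "b k = (if k < m then p (m - Suc k) else 0)" for k
      have A: "(\<Sum>k\<le>m. p (m - k) * r k) = real (Suc m) * p (Suc m)"
        by (rule rec[symmetric])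
      have B: "(\<Sum>k\<le>m. b k * r k) = real m * p m"
        using rec[of m'] Suc by (simp add: b_def)
      have C: "(\<Sum>k\<le>m. p (m - k) * r (Suc k)) = real (Suc (Suc m)) * p (Suc (Suc m)) - p (Suc m) * r 0"
        unfolding rec by (subst sum.atMost_Suc_shift) simp
      have D: "(\<Sum>k\<le>m. b k * r (Suc k)) = real (Suc m) * p (Suc m) - p m * r 0"
      proof -
        have "(\<Sum>k\<le>m. b k * r (Suc k)) = (\<Sum>k\<le>m'. p (m' - k) * r (Suc k))"
          using Suc by (simp add: b_def)
        then show ?thesis unfolding rec Suc by (subst sum.atMost_Suc_shift) simp
      qed
      have "(\<Sum>k\<le>m. p (m - k) * r (Suc k)) * (\<Sum>l\<le>m. b l * r l)
          \<le> (\<Sum>k\<le>m. p (m - k) * r k) * (\<Sum>l\<le>m. b l * r (Suc l))"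
      proof (rule sum_prod_difference_nonneg)
        fix k l assume kl: "k \<le> l" "l \<le> m"
        show "p (m - k) * b l \<le> p (m - l) * b k"
        proof (cases "l < m")
          case True
          then show ?thesis
            using kl cross[of "m - Suc l" "m - Suc k"]
            by (auto simp: b_def Suc_diff_Suc mult.commute)
        next
          case False
          then show ?thesis using pos by (auto simp: b_def intro: less_imp_le)
        qed
        show "r k * r (Suc l) \<le> r l * r (Suc k)"
          using log_concave_cross[of r l k] r_nonneg r_supp r_lc kl by (simp add: mult.commute)
      qed
      then have main: "(real (Suc (Suc m)) * p (Suc (Suc m)) - p (Suc m) * r 0) * (real m * p m)
          \<le> (real (Suc m) * p (Suc m)) * (real (Suc m) * p (Suc m) - p m * r 0)"
        unfolding A B C D .
      \<comment> \<open>the ratio at \<open>m\<close> is at most the ratio \<open>p 1 / p 0 = r 0\<close> at \<open>0\<close>\<close>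
      have "p 0 * p (Suc m) \<le> p 0 * (r 0 * p m)"
        using cross[of 0 m] p1 by (simp add: mult.commute mult.left_commute)
      then have "p (Suc m) \<le> r 0 * p m" using p0 by simp
      then have "0 \<le> p (Suc m) * (r 0 * p m - p (Suc m))" using pos[of "Suc m"] by simp
      moreover have "real m * real (Suc (Suc m)) * ((p (Suc m))\<^sup>2 - p m * p (Suc (Suc m)))
        = p (Suc m) * (r 0 * p m - p (Suc m))
          + (real (Suc m) * p (Suc m)) * (real (Suc m) * p (Suc m) - p m * r 0)
          - (real (Suc (Suc m)) * p (Suc (Suc m)) - p (Suc m) * r 0) * (real m * p m)"
        by (simp add: algebra_simps power2_eq_square)
      ultimately have "0 \<le> real m * real (Suc (Suc m)) * ((p (Suc m))\<^sup>2 - p m * p (Suc (Suc m)))"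
        using main by linarith
      moreover have "0 < real m * real (Suc (Suc m))" using Suc by simp
      ultimately show ?thesis by (simp only: zero_le_mult_iff) auto
    qed
  qed
qed

lemma conv_power_fps: "conv_power f y x = fps_nth (Abs_fps f ^ y) x"
proof (induction y arbitrary: x)
  case (Suc y)
  then show ?case by (simp add: convolution_def fps_mult_nth atMost_atLeast0)
qed simp

lemma conv_power_eq_0:
  assumes "f 0 = 0" "x < y"
  shows "conv_power f y x = 0"
  unfolding conv_power_fps using assms by (simp add: startsby_zero_power_prefix)

text \<open>
  The generating function of the compound Poisson distribution is \<open>exp (l (q(z) - 1))\<close>, with \<open>q\<close> that
  of \<open>Q\<close>. Since \<open>q(0) = 0\<close>, the composition makes sense formally and each coefficient is a finite sum.
\<close>

lemma compound_poisson_fps: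
  assumes "pmf Q 0 = 0"
  shows "compound_poisson Q l x = exp (- l) * fps_nth (fps_exp l oo Abs_fps (pmf Q)) x"
proof -
  have "compound_poisson Q l x = (\<Sum>y\<in>{0..x}. poisson_mass l y * conv_power (pmf Q) y x)"
    unfolding compound_poisson_def
    using assms by (intro suminf_finite) (auto simp: conv_power_eq_0)
  then show ?thesis
    by (simp add: fps_compose_nth poisson_mass_def conv_power_fps sum_distrib_left field_simps)
qed

text \<open>
  Panjer's recursion: compare coefficients in \<open>F' = F * (l q')\<close> for \<open>F = exp (l q)\<close>.
\<close>

lemma compound_poisson_recursion:
  assumes "pmf Q 0 = 0"
  shows "real (Suc n) * compound_poisson Q l (Suc n)
    = (\<Sum>k\<le>n. compound_poisson Q l (n - k) * (l * real (Suc k) * pmf Q (Suc k)))"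
proof -
  let ?q = "Abs_fps (pmf Q)" and ?F = "fps_exp l oo Abs_fps (pmf Q)"
  have "fps_deriv ?F = fps_const l * ?F * fps_deriv ?q"
    using assms by (simp add: fps_compose_deriv fps_compose_mult_distrib)
  then have "fps_deriv ?F = ?F * (fps_const l * fps_deriv ?q)" by (simp add: mult_ac)
  then have "fps_nth (fps_deriv ?F) n = (\<Sum>k=0..n. fps_nth ?F k * (l * real (Suc (n - k)) * pmf Q (Suc (n - k))))"
    by (simp add: fps_mult_nth[of ?F] mult.assoc)
  also have "\<dots> = (\<Sum>k\<le>n. fps_nth ?F (n - k) * (l * real (Suc k) * pmf Q (Suc k)))"
    unfolding atMost_atLeast0
    by (rule sum.reindex_bij_witness[of _ "\<lambda>k. n - k" "\<lambda>k. n - k"]) auto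
  finally show ?thesis
    using assms by (simp add: compound_poisson_fps sum_distrib_left algebra_simps)
qed

text \<open>
  Hansen's criterion applied to Panjer's recursion, that is with \<open>r k = l * (k + 1) * Q (k + 1)\<close>. This is
  a product of log-concave sequences, and \<open>r 1 \<le> (r 0)\<^sup>2\<close> is the hypothesis relating \<open>Q 1\<close> and \<open>Q 2\<close>.
\<close>

lemma compound_poisson_log_concave:
  assumes Q0: "pmf Q 0 = 0" and Q: "log_concave Q" and Q1: "0 < pmf Q 1"
    and l: "0 < l" and Q2: "2 * pmf Q 2 \<le> l * (pmf Q 1)\<^sup>2"
  shows "0 < compound_poisson Q l n"
    and "compound_poisson Q l n * compound_poisson Q l (Suc (Suc n)) \<le> (compound_poisson Q l (Suc n))\<^sup>2"
proof -
  define r where "r k = l * real (Suc k) * pmf Q (Suc k)" for k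
  have 1: "0 < compound_poisson Q l 0" using Q0 by (simp add: compound_poisson_fps)
  have 2: "real (Suc n) * compound_poisson Q l (Suc n) = (\<Sum>k\<le>n. compound_poisson Q l (n - k) * r k)" for n
    unfolding r_def by (rule compound_poisson_recursion[OF Q0])
  have 3: "0 \<le> r k" for k using l by (simp add: r_def)
  have 4: "0 < r 0" using l Q1 by (simp add: r_def)
  have 5: "interval_support r"
    unfolding interval_support_def
  proof (intro allI impI)
    fix a b c assume "a \<le> b" "b \<le> c" "r a \<noteq> 0" "r c \<noteq> 0"
    then have "Suc a \<le> Suc b" "Suc b \<le> Suc c" "pmf Q (Suc a) \<noteq> 0" "pmf Q (Suc c) \<noteq> 0"
      by (auto simp: r_def)
    then have "pmf Q (Suc b) \<noteq> 0"
      using Q unfolding log_concave_def interval_support_def by blast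
    then show "r b \<noteq> 0" using l by (simp add: r_def)
  qed
  have 6: "r k * r (Suc (Suc k)) \<le> (r (Suc k))\<^sup>2" for k
  proof -
    have "pmf Q (Suc k) * pmf Q (Suc (Suc (Suc k))) \<le> (pmf Q (Suc (Suc k)))\<^sup>2"
    proof -
      have "\<forall>x\<ge>1. pmf Q (x + 1) * pmf Q (x - 1) \<le> (pmf Q x)\<^sup>2"
        using Q unfolding log_concave_def by blast
      from this[rule_format, of "Suc (Suc k)"] show ?thesis by (simp add: mult.commute)
    qed
    moreover have "real (Suc k) * real (Suc (Suc (Suc k))) \<le> (real (Suc (Suc k)))\<^sup>2"
      by (simp add: power2_eq_square algebra_simps)
    ultimately have "l\<^sup>2 * ((real (Suc k) * real (Suc (Suc (Suc k)))) * (pmf Q (Suc k) * pmf Q (Suc (Suc (Suc k)))))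
       \<le> l\<^sup>2 * ((real (Suc (Suc k)))\<^sup>2 * (pmf Q (Suc (Suc k)))\<^sup>2)"
      by (intro mult_left_mono mult_mono) auto
    then show ?thesis unfolding r_def power_mult_distrib by (simp only: power2_eq_square mult.assoc mult.left_commute)
  qed
  have "l * (2 * pmf Q 2) \<le> l * (l * (pmf Q 1)\<^sup>2)" using Q2 l by simp
  moreover have "r 1 = l * (2 * pmf Q 2)" by (simp add: r_def Suc_1[symmetric] del: Suc_1)
  moreover have "(r 0)\<^sup>2 = l * (l * (pmf Q 1)\<^sup>2)" by (simp add: r_def power2_eq_square)
  ultimately have 7: "r 1 \<le> (r 0)\<^sup>2" by simp
  show "0 < compound_poisson Q l n"
    and "compound_poisson Q l n * compound_poisson Q l (Suc (Suc n)) \<le> (compound_poisson Q l (Suc n))\<^sup>2"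
    by (rule log_concave_of_recursion[where p = "compound_poisson Q l" and r = r, OF 1 2 3 4 5 6 7])+
qed


section \<open>Convex sequences and the convex order\<close>

lemma convex_seq_increments_mono:
  fixes g :: "nat \<Rightarrow> real"
  assumes "\<And>k. 2 * g (Suc k) \<le> g k + g (Suc (Suc k))" and "i \<le> j"
  shows "g (Suc i) - g i \<le> g (Suc j) - g j"
proof -
  have "incseq (\<lambda>k. g (Suc k) - g k)"
  proof (rule incseq_SucI)
    fix k show "g (Suc k) - g k \<le> g (Suc (Suc k)) - g (Suc k)" using assms(1)[of k] by simp
  qed
  then show ?thesis using \<open>i \<le> j\<close> by (rule incseqD)
qed

text \<open>
  A convex sequence lies below its chords: compare the slopes on both sides of \<open>b\<close> with the increment
  at \<open>b\<close>. Multiplying out the denominators lets the same inequality also say that the sequence lies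
  above a chord outside of its end points.
\<close>

lemma convex_seq_chord:
  fixes g :: "nat \<Rightarrow> real"
  assumes conv: "\<And>k. 2 * g (Suc k) \<le> g k + g (Suc (Suc k))" and "a \<le> b" "b \<le> c"
  shows "(real c - real a) * g b \<le> (real c - real b) * g a + (real b - real a) * g c"
proof -
  note mono = convex_seq_increments_mono[of g, OF conv]
  let ?d = "g (Suc b) - g b"
  have below: "g (a + n) - g a \<le> real n * ?d" if "a + n \<le> b" for n
    using that
  proof (induction n)
    case (Suc n)
    then show ?case using mono[of "a + n" b] by (simp add: algebra_simps)
  qed simp
  have above: "real m * ?d \<le> g (b + m) - g b" for m
  proof (induction m)
    case (Suc m)
    then show ?case using mono[of b "b + m"] by (simp add: algebra_simps)
  qed simp
  have "(real c - real b) * (g b - g a) \<le> (real c - real b) * ((real b - real a) * ?d)"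
    using below[of "b - a"] assms by (intro mult_left_mono) (auto simp: of_nat_diff)
  also have "\<dots> = (real b - real a) * ((real c - real b) * ?d)" by simp
  also have "\<dots> \<le> (real b - real a) * (g c - g b)"
    using above[of "c - b"] assms by (intro mult_left_mono) (auto simp: of_nat_diff)
  finally show ?thesis by (simp add: algebra_simps)
qed

lemma convex_seq_exchange:
  fixes g :: "nat \<Rightarrow> real"
  assumes conv: "\<And>k. 2 * g (Suc k) \<le> g k + g (Suc (Suc k))"
  shows "g (x + s) + g (y + s) \<le> g s + g (x + (y + s))"
proof (induction x)
  case (Suc x)
  then show ?case
    using convex_seq_increments_mono[of g "x + s" "x + (y + s)", OF conv] by simp
qed simp

text \<open>
  Two distributions with equal means are in convex order if one exceeds the other exactly on an
  interval. Take the chord \<open>\<ell>\<close> of \<open>g\<close> over this interval. Then \<open>g - \<ell>\<close> is nonpositive where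
  \<open>P > R\<close> and nonnegative where \<open>P \<le> R\<close>, so \<open>E\<^sub>P (g - \<ell>) \<le> E\<^sub>R (g - \<ell>)\<close>, and \<open>\<ell>\<close> has the same
  expectation under both as it is affine.
\<close>

theorem expectation_convex_mono:
  fixes P R :: "nat pmf" and g :: "nat \<Rightarrow> real"
  assumes conv: "\<And>k. 2 * g (Suc k) \<le> g k + g (Suc (Suc k))"
    and fin: "finite (set_pmf P)"
    and int: "integrable (measure_pmf R) real" "integrable (measure_pmf R) g"
    and mean: "measure_pmf.expectation P real = measure_pmf.expectation R real"
    and between: "\<And>a b c. \<lbrakk>a \<le> b; b \<le> c; pmf R a < pmf P a; pmf R c < pmf P c\<rbrakk> \<Longrightarrow> pmf R b < pmf P b"
  shows "measure_pmf.expectation P g \<le> measure_pmf.expectation R g"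
proof -
  define A where "A = {k. pmf R k < pmf P k}"
  have "A \<subseteq> set_pmf P" unfolding A_def
    by (auto simp: set_pmf_iff simp flip: not_le)
  then have finA: "finite A" using fin by (rule finite_subset)
  \<comment> \<open>A singleton or empty \<open>A\<close> gives no chord; any chord of length one then works, because a convex sequence lies above it at every integer.\<close>
  obtain a c where ac: "a < c" "A \<subseteq> {a..c}" "{a<..<c} \<subseteq> A"
  proof (cases "A = {}")
    case True
    moreover have "{0<..<1::nat} = {}" by auto
    ultimately show ?thesis using that[of 0 1] by simp
  next
    case False
    show ?thesis
    proof (rule that[of "Min A" "max (Max A) (Suc (Min A))"])
      show "A \<subseteq> {Min A..max (Max A) (Suc (Min A))}"
        using finA by (auto intro!: max.coboundedI1)
      show "{Min A<..<max (Max A) (Suc (Min A))} \<subseteq> A"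
      proof
        fix k assume "k \<in> {Min A<..<max (Max A) (Suc (Min A))}"
        then have "Min A \<le> k" "k \<le> Max A" by auto
        moreover have "Min A \<in> A" "Max A \<in> A" using False finA by auto
        ultimately show "k \<in> A" using between[of "Min A" k "Max A"] by (auto simp: A_def)
      qed
    qed simp
  qed
  define s where "s = (g c - g a) / (real c - real a)"
  \<comment> \<open>the deviation of \<open>g\<close> from its chord between \<open>a\<close> and \<open>c\<close>\<close>
  define \<phi> where "\<phi> k = g k - (g a + s * (real k - real a))" for k
  have s: "(real c - real a) * s = g c - g a" using ac by (simp add: s_def)
  have \<phi>: "(real c - real a) * \<phi> k = (real c - real a) * g k - ((real c - real k) * g a + (real k - real a) * g c)" for k
  proof -
    have "(real c - real a) * \<phi> k
      = (real c - real a) * g k - (real c - real a) * g a - ((real c - real a) * s) * (real k - real a)"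
      by (simp add: \<phi>_def algebra_simps)
    then show ?thesis unfolding s by (simp add: algebra_simps)
  qed
  have pos: "real c - real a > 0" using ac by simp
  have sign: "pmf P k * \<phi> k \<le> pmf R k * \<phi> k" for k
  proof (cases "k \<in> A")
    case True
    then have "(real c - real a) * \<phi> k \<le> 0"
      using convex_seq_chord[of g a k c, OF conv] ac unfolding \<phi> by auto
    then have "\<phi> k \<le> 0" using pos by (simp add: mult_le_0_iff)
    then show ?thesis using True by (intro mult_right_mono_neg) (auto simp: A_def)
  next
    case False
    then have "k \<le> a \<or> c \<le> k" using ac(3) by (meson greaterThanLessThan_iff not_less subsetD)
    then have "0 \<le> (real c - real a) * \<phi> k"
      using convex_seq_chord[of g k a c, OF conv] convex_seq_chord[of g a c k, OF conv] ac(1)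
      unfolding \<phi> by (auto simp: algebra_simps)
    then have "0 \<le> \<phi> k" using pos by (simp add: zero_le_mult_iff)
    then show ?thesis using False by (intro mult_right_mono) (auto simp: A_def)
  qed
  have intP: "integrable (measure_pmf P) h" for h :: "nat \<Rightarrow> real"
    using fin by (rule integrable_measure_pmf_finite)
  have intR: "integrable (measure_pmf R) \<phi>" unfolding \<phi>_def using int by auto
  have cs: "integrable (count_space UNIV) (\<lambda>k. pmf p k * \<phi> k)"
      "measure_pmf.expectation p \<phi> = (\<integral>k. pmf p k * \<phi> k \<partial>count_space UNIV)"
    if "integrable (measure_pmf p) \<phi>" for p
    using that unfolding measure_pmf_eq_density
    by (simp_all add: integrable_density integral_density)
  have "measure_pmf.expectation P \<phi> \<le> measure_pmf.expectation R \<phi>"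
    unfolding cs(2)[OF intP] cs(2)[OF intR]
    by (intro integral_mono cs intP intR sign)
  moreover have "measure_pmf.expectation p \<phi>
      = measure_pmf.expectation p g - (g a + s * (measure_pmf.expectation p real - real a))"
    if "integrable (measure_pmf p) g" "integrable (measure_pmf p) real" for p
    unfolding \<phi>_def using that by simp
  ultimately show ?thesis using int intP mean by simp
qed

text \<open>
  The same comparison for extended nonnegative sequences. If the integral under \<open>R\<close> is finite, then \<open>G\<close>
  is finite everywhere since \<open>R\<close> charges every point, and the real-valued case applies. Expectations
  of random sums under an arbitrary nonnegative function are sequences of this kind.
\<close>

lemma nn_integral_convex_mono:
  fixes P R :: "nat pmf" and G :: "nat \<Rightarrow> ennreal"
  assumes conv: "\<And>k. G (Suc k) + G (Suc k) \<le> G k + G (Suc (Suc k))"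
    and fin: "finite (set_pmf P)" and full: "set_pmf R = UNIV"
    and int: "integrable (measure_pmf R) real"
    and mean: "measure_pmf.expectation P real = measure_pmf.expectation R real"
    and between: "\<And>a b c. \<lbrakk>a \<le> b; b \<le> c; pmf R a < pmf P a; pmf R c < pmf P c\<rbrakk> \<Longrightarrow> pmf R b < pmf P b"
  shows "(\<integral>\<^sup>+k. G k \<partial>P) \<le> (\<integral>\<^sup>+k. G k \<partial>R)"
proof (cases "(\<integral>\<^sup>+k. G k \<partial>R) = \<infinity>")
  case False
  then have "AE k in measure_pmf R. G k \<noteq> \<infinity>" by (intro nn_integral_PInf_AE) auto
  then have G_fin: "G k \<noteq> \<infinity>" for k using full by (simp add: AE_measure_pmf_iff)
  define g where "g k = enn2real (G k)" for k
  have G: "G k = ennreal (g k)" for k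
    using G_fin[of k] by (simp add: g_def less_top)
  have g0: "0 \<le> g k" for k by (simp add: g_def)
  have g_conv: "2 * g (Suc k) \<le> g k + g (Suc (Suc k))" for k
    using conv[of k] unfolding G by (simp add: ennreal_plus[symmetric] g0 del: ennreal_plus)
  have intR: "integrable (measure_pmf R) g"
    using False by (intro integrableI_nonneg) (auto simp: g0 G[symmetric] less_top)
  have intP: "integrable (measure_pmf P) g" using fin by (rule integrable_measure_pmf_finite)
  have "measure_pmf.expectation P g \<le> measure_pmf.expectation R g"
    by (rule expectation_convex_mono[OF g_conv fin int intR mean between])
  then show ?thesis unfolding G
    by (simp add: nn_integral_eq_integral[OF intP] nn_integral_eq_integral[OF intR] g0)
qed simp

lemma poisson_pmf_mean:
  assumes "0 < l"
  shows "integrable (measure_pmf (poisson_pmf l)) real"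
    and "measure_pmf.expectation (poisson_pmf l) real = l"
proof -
  let ?p = "\<lambda>k. pmf (poisson_pmf l) k"
  have "(\<lambda>k. exp (- l) * (l ^ k /\<^sub>R fact k)) sums (exp (- l) * exp l)"
    by (intro sums_mult exp_converges)
  then have "?p sums 1" using assms by (simp add: exp_minus field_simps)
  then have "(\<lambda>k. l * ?p k) sums (l * 1)" by (rule sums_mult)
  also have "(\<lambda>k. l * ?p k) = (\<lambda>k. ?p (Suc k) * real (Suc k))"
    using assms by (simp add: field_simps fun_eq_iff del: of_nat_Suc)
  finally have sums: "(\<lambda>k. ?p k * real k) sums l" by (subst (asm) sums_Suc_iff) simp
  have int: "integrable (count_space UNIV) (\<lambda>k. ?p k * real k)"
    using sums assms by (simp add: integrable_count_space_nat_iff sums_iff)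
  show "integrable (measure_pmf (poisson_pmf l)) real"
    using int unfolding measure_pmf_eq_density by (simp add: integrable_density)
  show "measure_pmf.expectation (poisson_pmf l) real = l"
    using sums_unique2[OF sums_integral_count_space_nat[OF int] sums]
    unfolding measure_pmf_eq_density by (simp add: integral_density)
qed


section \<open>Random sums of i.i.d. variables\<close>

text \<open>
  The convolution powers of \<open>Q\<close> in the form of probability mass functions, so that a random sum is a
  monadic bind and expectations over it are iterated integrals.
\<close>

primrec iid_sum :: "nat pmf \<Rightarrow> nat \<Rightarrow> nat pmf" where
  "iid_sum Q 0 = return_pmf 0"
| "iid_sum Q (Suc k) = bind_pmf Q (\<lambda>x. map_pmf ((+) x) (iid_sum Q k))"

lemma pmf_iid_sum: "pmf (iid_sum Q k) x = conv_power (pmf Q) k x"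
proof (induction k arbitrary: x)
  case 0
  show ?case by (simp add: indicator_def)
next
  case (Suc k)
  have shift: "pmf (map_pmf ((+) y) (iid_sum Q k)) x = (if y \<le> x then pmf (iid_sum Q k) (x - y) else 0)" for y
  proof (cases "y \<le> x")
    case True
    then show ?thesis using pmf_map_inj'[of "(+) y" "iid_sum Q k" "x - y"] by simp
  next
    case False
    then show ?thesis by (auto simp: pmf_eq_0_set_pmf)
  qed
  have "pmf (iid_sum Q (Suc k)) x = (\<integral>y. (if y \<le> x then pmf (iid_sum Q k) (x - y) else 0) \<partial>measure_pmf Q)"
    by (simp add: pmf_bind shift)
  also have "\<dots> = (\<Sum>y\<le>x. pmf Q y * pmf (iid_sum Q k) (x - y))"
    by (subst integral_measure_pmf[where A = "{..x}"]) (auto split: if_splits)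
  finally show ?case by (simp add: Suc.IH convolution_def)
qed

lemma compound_poisson_eq_pmf:
  assumes "pmf Q 0 = 0" "0 < l"
  shows "compound_poisson Q l x = pmf (bind_pmf (poisson_pmf l) (iid_sum Q)) x"
proof -
  have "compound_poisson Q l x = (\<Sum>y\<le>x. poisson_mass l y * conv_power (pmf Q) y x)"
    unfolding compound_poisson_def
    using assms by (intro suminf_finite) (auto simp: conv_power_eq_0)
  also have "\<dots> = (\<integral>y. conv_power (pmf Q) y x \<partial>measure_pmf (poisson_pmf l))"
    using assms
    by (subst integral_measure_pmf[where A = "{..x}"])
      (auto simp: conv_power_eq_0 poisson_mass_def mult_ac intro: leI)
  finally show ?thesis by (simp add: pmf_bind pmf_iid_sum)
qed

text \<open>
  The expectation of a convex function \<open>f\<close> of a sum of \<open>k\<close> i.i.d. nonnegative variables is convex in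
  \<open>k\<close>. Let \<open>S\<close> be the sum of the first \<open>k\<close> and let \<open>X\<close>, \<open>Y\<close> be the next two; then
  \<open>f (X + S) + f (Y + S) \<le> f S + f (X + Y + S)\<close> pointwise, and both terms on the left have the same
  expectation.
\<close>

lemma iid_sum_convex:
  fixes f :: "nat \<Rightarrow> real" and Q :: "nat pmf"
  assumes f0: "\<And>k. 0 \<le> f k" and conv: "\<And>k. 2 * f (Suc k) \<le> f k + f (Suc (Suc k))"
  defines "G \<equiv> \<lambda>k. \<integral>\<^sup>+x. ennreal (f x) \<partial>measure_pmf (iid_sum Q k)"
  shows "G (Suc k) + G (Suc k) \<le> G k + G (Suc (Suc k))"
proof -
  let ?S = "measure_pmf (iid_sum Q k)" and ?Q = "measure_pmf Q"
  have S: "G (Suc k) = (\<integral>\<^sup>+x. \<integral>\<^sup>+s. ennreal (f (x + s)) \<partial>?S \<partial>?Q)"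
    and SS: "G (Suc (Suc k)) = (\<integral>\<^sup>+x. \<integral>\<^sup>+y. \<integral>\<^sup>+s. ennreal (f (x + (y + s))) \<partial>?S \<partial>?Q \<partial>?Q)"
    by (simp_all add: G_def nn_integral_bind_pmf nn_integral_map_pmf)
  have const: "(\<integral>\<^sup>+x. c \<partial>measure_pmf M) = c" for c :: ennreal and M :: "nat pmf"
    by (simp add: measure_pmf.emeasure_space_1)
  \<comment> \<open>Each copy of \<open>G (Suc k)\<close> is integrated over one further variable, \<open>y\<close> or \<open>x\<close>, that it is constant in.\<close>
  have "G (Suc k) + G (Suc k) = (\<integral>\<^sup>+x. \<integral>\<^sup>+y. \<integral>\<^sup>+s. ennreal (f (x + s)) + ennreal (f (y + s)) \<partial>?S \<partial>?Q \<partial>?Q)"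
    by (simp add: nn_integral_add const flip: S)
  also have "\<dots> \<le> (\<integral>\<^sup>+x. \<integral>\<^sup>+y. \<integral>\<^sup>+s. ennreal (f s) + ennreal (f (x + (y + s))) \<partial>?S \<partial>?Q \<partial>?Q)"
    using convex_seq_exchange[of f, OF conv]
    by (intro nn_integral_mono) (simp add: f0 flip: ennreal_plus)
  also have "\<dots> = G k + G (Suc (Suc k))"
    unfolding SS by (simp add: nn_integral_add const) (simp add: G_def)
  finally show ?thesis .
qed


section \<open>The maximum entropy property\<close>

lemma entropy_term_nonneg: "0 \<le> - (pmf P x * ln (pmf P x))" for P :: "nat pmf"
  using pmf_nonneg[of P x] pmf_le_1[of P x]
  by (cases "pmf P x = 0") (auto simp: mult_le_0_iff)

lemma discrete_entropy_eq_nn_integral: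
  "discrete_entropy (pmf P) = (\<integral>\<^sup>+x. ennreal (- ln (pmf P x)) \<partial>measure_pmf P)"
  unfolding discrete_entropy_def nn_integral_measure_pmf nn_integral_count_space_nat
  by (simp add: ennreal_mult'[symmetric])

text \<open>
  Gibbs' inequality. Integrating \<open>- P ln P + P \<le> - P ln R + R\<close>, a form of \<open>ln t \<le> t - 1\<close>, in the
  extended nonnegative reals avoids the difference of two possibly infinite sums; the total masses \<open>1\<close>
  on both sides cancel in the end.
\<close>

lemma discrete_entropy_le_cross_entropy:
  fixes P R :: "nat pmf"
  assumes R: "\<And>x. 0 < pmf R x"
  shows "discrete_entropy (pmf P) \<le> (\<integral>\<^sup>+x. ennreal (- ln (pmf R x)) \<partial>measure_pmf P)"
proof -
  have bound: "ennreal (- (pmf P x * ln (pmf P x))) + ennreal (pmf P x)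
      \<le> ennreal (pmf P x) * ennreal (- ln (pmf R x)) + ennreal (pmf R x)" for x
  proof -
    have lnR: "0 \<le> - ln (pmf R x)" using R[of x] pmf_le_1[of R x] by simp
    have "- (pmf P x * ln (pmf P x)) + pmf P x \<le> pmf P x * (- ln (pmf R x)) + pmf R x"
    proof (cases "pmf P x = 0")
      case False
      then have pos: "0 < pmf P x" using pmf_nonneg[of P x] by simp
      have "ln (pmf R x / pmf P x) \<le> pmf R x / pmf P x - 1"
        using pos R[of x] by (intro ln_le_minus_one) auto
      then have "pmf P x * (ln (pmf R x) - ln (pmf P x)) \<le> pmf P x * (pmf R x / pmf P x - 1)"
        using pos R[of x] by (simp add: ln_div)
      also have "\<dots> = pmf R x - pmf P x" using pos by (simp add: field_simps)
      finally show ?thesis by (simp add: algebra_simps)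
    qed (use R[of x] in simp)
    then have "ennreal (- (pmf P x * ln (pmf P x)) + pmf P x) \<le> ennreal (pmf P x * (- ln (pmf R x)) + pmf R x)"
      by (rule ennreal_leI)
    moreover have "ennreal (- (pmf P x * ln (pmf P x)) + pmf P x)
        = ennreal (- (pmf P x * ln (pmf P x))) + ennreal (pmf P x)"
      by (intro ennreal_plus entropy_term_nonneg pmf_nonneg)
    moreover have "ennreal (pmf P x * (- ln (pmf R x)) + pmf R x)
        = ennreal (pmf P x * (- ln (pmf R x))) + ennreal (pmf R x)"
      using lnR by (intro ennreal_plus mult_nonneg_nonneg pmf_nonneg)
    moreover have "ennreal (pmf P x * (- ln (pmf R x))) = ennreal (pmf P x) * ennreal (- ln (pmf R x))"
      by (intro ennreal_mult' pmf_nonneg)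
    ultimately show ?thesis by simp
  qed
  have one: "(\<integral>\<^sup>+x. ennreal (pmf M x) \<partial>count_space UNIV) = 1" for M :: "nat pmf"
    using nn_integral_pmf[of UNIV M] by (simp add: measure_pmf.emeasure_space_1)
  have "discrete_entropy (pmf P) + 1
      = (\<integral>\<^sup>+x. ennreal (- (pmf P x * ln (pmf P x))) + ennreal (pmf P x) \<partial>count_space UNIV)"
    unfolding discrete_entropy_def nn_integral_count_space_nat[symmetric]
    by (simp add: nn_integral_add one)
  also have "\<dots> \<le> (\<integral>\<^sup>+x. ennreal (pmf P x) * ennreal (- ln (pmf R x)) + ennreal (pmf R x) \<partial>count_space UNIV)"
    by (intro nn_integral_mono bound)
  also have "\<dots> = (\<integral>\<^sup>+x. ennreal (- ln (pmf R x)) \<partial>measure_pmf P) + 1"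
    by (simp add: nn_integral_add one nn_integral_measure_pmf)
  finally show ?thesis by simp
qed

text \<open>
  Ultra-log-concavity says precisely that the quotient of \<open>f\<close> by the Poisson mass function is
  log-concave, so this quotient exceeds \<open>1\<close> on an interval.
\<close>

lemma ultra_log_concave_exceeds_poisson_between:
  assumes ulc: "ultra_log_concave f" and l: "0 < l"
    and ord: "a \<le> b" "b \<le> c"
    and above: "pmf (poisson_pmf l) a < f a" "pmf (poisson_pmf l) c < f c"
  shows "pmf (poisson_pmf l) b < f b"
proof -
  \<comment> \<open>the quotient by the Poisson mass function, up to the factor \<open>exp l\<close>\<close>
  define h where "h k = f k * fact k / l ^ k" for k
  have f0: "0 \<le> f k" for k using ulc by (simp add: ultra_log_concave_def)
  have iff: "pmf (poisson_pmf l) k < f k \<longleftrightarrow> exp (- l) < h k" for k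
    using l by (simp add: h_def field_simps)
  have "exp (- l) < h b"
  proof (rule log_concave_superlevel[OF _ _ _ ord])
    show "0 \<le> h k" for k using f0 l by (simp add: h_def)
    show "interval_support h"
      using ulc l by (simp add: ultra_log_concave_def interval_support_def h_def)
    show "h k * h (Suc (Suc k)) \<le> (h (Suc k))\<^sup>2" for k
    proof -
      have "\<forall>k\<ge>1. real (k + 1) * f (k + 1) * f (k - 1) \<le> real k * (f k)\<^sup>2"
        using ulc by (simp add: ultra_log_concave_def)
      from this[rule_format, of "Suc k"]
      have *: "real (Suc (Suc k)) * (f (Suc (Suc k)) * f k) \<le> real (Suc k) * (f (Suc k))\<^sup>2"
        by (simp add: mult.assoc)
      let ?c = "real (Suc k) * (fact k)\<^sup>2 / (l ^ Suc k)\<^sup>2"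
      have "h k * h (Suc (Suc k)) = ?c * (real (Suc (Suc k)) * (f (Suc (Suc k)) * f k))"
        by (simp add: h_def power2_eq_square mult_ac)
      also have "\<dots> \<le> ?c * (real (Suc k) * (f (Suc k))\<^sup>2)"
        using * by (intro mult_left_mono) auto
      also have "\<dots> = (h (Suc k))\<^sup>2"
        by (simp add: h_def power2_eq_square mult_ac)
      finally show ?thesis .
    qed
  qed (use above iff in auto)
  then show ?thesis by (simp add: iff)
qed

text \<open>
  Let \<open>R\<close> be the compound Poisson distribution. The function \<open>f = - ln R\<close> is nonnegative and convex.
  The number of summands \<open>N\<close> precedes the Poisson distribution in the convex order, hence so do the
  two random sums, and Gibbs' inequality followed by this comparison gives
  \<open>H(S) \<le> E\<^sub>S f \<le> E\<^sub>R f = H(R)\<close> for the law \<open>S\<close> of the random sum with \<open>N\<close> summands.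
\<close>

theorem compound_poisson_max_entropy:
  fixes N Q :: "nat pmf"
  assumes ulc: "ultra_log_concave (pmf N)" and fin: "finite (set_pmf N)"
    and Q0: "pmf Q 0 = 0" and Q: "log_concave Q" and Q1: "0 < pmf Q 1"
    and Q2: "2 * pmf Q 2 \<le> measure_pmf.expectation N real * (pmf Q 1)\<^sup>2"
  shows "discrete_entropy (pmf (bind_pmf N (iid_sum Q)))
    \<le> discrete_entropy (compound_poisson Q (measure_pmf.expectation N real))"
proof -
  define l where "l = measure_pmf.expectation N real"
  have intN: "integrable (measure_pmf N) real" using fin by (rule integrable_measure_pmf_finite)
  show ?thesis
  \<comment> \<open>If the mean is \<open>0\<close>, then the sum is empty and its entropy is \<open>0\<close>.\<close>
  proof (cases "l = 0")
    case True
    then have "AE k in measure_pmf N. real k = 0"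
      using integral_nonneg_eq_0_iff_AE[OF intN] by (simp add: l_def)
    then have "set_pmf N \<subseteq> {0}" by (auto simp: AE_measure_pmf_iff)
    then have "N = return_pmf 0" by (simp add: set_pmf_subset_singleton)
    then have "discrete_entropy (pmf (bind_pmf N (iid_sum Q))) = 0"
      by (simp add: discrete_entropy_eq_nn_integral bind_return_pmf)
    then show ?thesis by simp
  next
    case False
    moreover have "0 \<le> l" by (simp add: l_def)
    ultimately have l: "0 < l" by simp
    define R where "R = bind_pmf (poisson_pmf l) (iid_sum Q)"
    have R: "compound_poisson Q l = pmf R"
      using compound_poisson_eq_pmf[OF Q0 l] by (simp add: R_def fun_eq_iff)
    define f where "f x = - ln (pmf R x)" for x
    note R_lc = compound_poisson_log_concave[OF Q0 Q Q1 l Q2[folded l_def], unfolded R]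
    have f0: "0 \<le> f x" for x using R_lc(1)[of x] pmf_le_1[of R x] by (simp add: f_def)
    have f_conv: "2 * f (Suc x) \<le> f x + f (Suc (Suc x))" for x
    proof -
      have "ln (pmf R x * pmf R (Suc (Suc x))) \<le> ln ((pmf R (Suc x))\<^sup>2)"
        using R_lc by (intro ln_mono) auto
      then show ?thesis
        using R_lc(1)[of x] R_lc(1)[of "Suc (Suc x)"] by (simp add: f_def ln_mult ln_realpow)
    qed
    have "discrete_entropy (pmf (bind_pmf N (iid_sum Q)))
        \<le> (\<integral>\<^sup>+x. ennreal (f x) \<partial>measure_pmf (bind_pmf N (iid_sum Q)))"
      unfolding f_def by (rule discrete_entropy_le_cross_entropy[OF R_lc(1)])
    also have "\<dots> = (\<integral>\<^sup>+k. \<integral>\<^sup>+x. ennreal (f x) \<partial>measure_pmf (iid_sum Q k) \<partial>measure_pmf N)"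
      by (rule nn_integral_bind_pmf)
    also have "\<dots> \<le> (\<integral>\<^sup>+k. \<integral>\<^sup>+x. ennreal (f x) \<partial>measure_pmf (iid_sum Q k) \<partial>measure_pmf (poisson_pmf l))"
    proof (rule nn_integral_convex_mono[
          where G = "\<lambda>k. \<integral>\<^sup>+x. ennreal (f x) \<partial>measure_pmf (iid_sum Q k)",
          OF iid_sum_convex[of f, OF f0 f_conv] fin])
      show "measure_pmf.expectation N real = measure_pmf.expectation (poisson_pmf l) real"
        unfolding poisson_pmf_mean[OF l] by (simp add: l_def)
    qed (use l in \<open>simp_all only: set_pmf_poisson poisson_pmf_mean
          ultra_log_concave_exceeds_poisson_between[OF ulc l]\<close>)
    also have "\<dots> = (\<integral>\<^sup>+x. ennreal (f x) \<partial>measure_pmf R)"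
      unfolding R_def by (rule nn_integral_bind_pmf[symmetric])
    also have "\<dots> = discrete_entropy (compound_poisson Q l)"
      unfolding f_def R by (rule discrete_entropy_eq_nn_integral[symmetric])
    finally show ?thesis by (simp add: l_def)
  qed
qed


section \<open>The law of the random weight\<close>

lemma measurable_sum_count_space:
  fixes f :: "'i \<Rightarrow> 'a \<Rightarrow> nat"
  assumes "\<And>i. i \<in> A \<Longrightarrow> f i \<in> measurable M (count_space UNIV)"
  shows "(\<lambda>x. \<Sum>i\<in>A. f i x) \<in> measurable M (count_space UNIV)"
proof -
  have eq: "measurable M (count_space UNIV) = (measurable M borel :: ('a \<Rightarrow> nat) set)"
    by (rule measurable_cong_sets) (simp_all add: sets_borel_eq_count_space)
  show ?thesis using assms unfolding eq by (rule borel_measurable_sum)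
qed

lemma (in prob_space) prob_iid_sum:
  fixes X :: "'i \<Rightarrow> 'a \<Rightarrow> nat"
  assumes indep: "indep_vars (\<lambda>_. count_space UNIV) X J"
    and law: "\<And>i. i \<in> J \<Longrightarrow> distr M (count_space UNIV) (X i) = measure_pmf Q"
    and A: "finite A" "A \<subseteq> J"
  shows "prob {\<omega> \<in> space M. (\<Sum>i\<in>A. X i \<omega>) = x} = conv_power (pmf Q) (card A) x"
  using A
proof (induction A arbitrary: x rule: finite_induct)
  case empty
  then show ?case by (simp add: prob_space)
next
  case (insert i A)
  have rv: "X j \<in> measurable M (count_space UNIV)" if "j \<in> J" for j
    using indep that by (simp add: indep_vars_def)
  define S where "S = (\<lambda>\<omega>. \<Sum>j\<in>A. X j \<omega>)"
  have S_rv: "S \<in> measurable M (count_space UNIV)"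
    unfolding S_def using insert.prems rv by (intro measurable_sum_count_space) auto
  have "indep_vars (\<lambda>_. count_space UNIV) X (insert i A)"
    using indep insert.prems by (rule indep_vars_subset)
  then have "indep_var
      (count_space UNIV) ((\<lambda>f. f i) \<circ> (\<lambda>\<omega>. restrict (\<lambda>j. X j \<omega>) {i}))
      (count_space UNIV) ((\<lambda>f. \<Sum>j\<in>A. f j) \<circ> (\<lambda>\<omega>. restrict (\<lambda>j. X j \<omega>) A))"
    using insert.hyps
    by (intro indep_var_compose[OF indep_var_restrict] measurable_sum_count_space) auto
  moreover have "(\<lambda>f. f i) \<circ> (\<lambda>\<omega>. restrict (\<lambda>j. X j \<omega>) {i}) = X i"
    by auto
  moreover have "(\<lambda>f. \<Sum>j\<in>A. f j) \<circ> (\<lambda>\<omega>. restrict (\<lambda>j. X j \<omega>) A) = S"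
    by (auto simp: S_def)
  ultimately have XS: "indep_var (count_space UNIV) (X i) (count_space UNIV) S" by simp
  have Xi: "prob {\<omega> \<in> space M. X i \<omega> = y} = pmf Q y" for y
  proof -
    have "pmf Q y = measure (distr M (count_space UNIV) (X i)) {y}"
      using law[of i] insert.prems by (simp add: measure_pmf_single)
    also have "\<dots> = prob (X i -` {y} \<inter> space M)"
      using rv[of i] insert.prems by (intro measure_distr) auto
    finally show ?thesis by (simp add: vimage_def Int_def conj_commute)
  qed
  define B where "B y = {\<omega> \<in> space M. X i \<omega> = y \<and> S \<omega> = x - y}" for y
  have B_ev: "B y \<in> events" for y
  proof -
    have "B y = (X i -` {y} \<inter> space M) \<inter> (S -` {x - y} \<inter> space M)"
      by (auto simp: B_def)
    then show ?thesis using rv[of i] S_rv insert.prems by (auto intro!: measurable_sets)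
  qed
  have "{\<omega> \<in> space M. (\<Sum>j\<in>insert i A. X j \<omega>) = x} = (\<Union>y\<le>x. B y)"
    using insert.hyps by (auto simp: B_def S_def)
  then have "prob {\<omega> \<in> space M. (\<Sum>j\<in>insert i A. X j \<omega>) = x} = (\<Sum>y\<le>x. prob (B y))"
    using B_ev
    by (simp only:) (intro finite_measure_finite_Union, auto simp: disjoint_family_on_def B_def)
  also have "\<dots> = (\<Sum>y\<le>x. pmf Q y * conv_power (pmf Q) (card A) (x - y))"
  proof (intro sum.cong refl)
    fix y
    have "prob (B y) = prob (X i -` {y} \<inter> space M) * prob (S -` {x - y} \<inter> space M)"
      using indep_varD[OF XS, of "{y}" "{x - y}"]
      by (simp add: B_def vimage_def Int_def conj_commute conj_assoc)
    also have "\<dots> = pmf Q y * conv_power (pmf Q) (card A) (x - y)"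
      using Xi[of y] insert by (simp add: S_def vimage_def Int_def conj_commute)
    finally show "prob (B y) = pmf Q y * conv_power (pmf Q) (card A) (x - y)" .
  qed
  finally show ?case using insert.hyps by (simp add: convolution_def)
qed

text \<open>
  Conditionally on the chosen set \<open>A\<close>, the weight is a sum of \<open>card A\<close> i.i.d. variables, since the choice is
  independent of the whole family of weights. So the law of the random weight depends on the set system
  only through the law of the cardinality.
\<close>

lemma prob_random_weight:
  fixes X :: "nat \<Rightarrow> 'a \<Rightarrow> nat"
  assumes prob: "prob_space \<Omega>" and E: "finite E"
    and ind: "finite ind" "ind \<noteq> {}" "\<And>A. A \<in> ind \<Longrightarrow> A \<subseteq> E"
    and I_meas: "I \<in> measurable \<Omega> (count_space ind)"
    and I_uniform: "distr \<Omega> (count_space ind) I = uniform_count_measure ind"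
    and X_law: "\<And>i. i \<in> E \<Longrightarrow> distr \<Omega> (count_space UNIV) (X i) = measure_pmf Q"
    and X_indep: "prob_space.indep_vars \<Omega> (\<lambda>_. count_space UNIV) X E"
    and I_X_indep: "indep_elements \<Omega> (count_space ind) I
          (PiM E (\<lambda>_. count_space UNIV)) (\<lambda>\<omega>. \<lambda>i\<in>E. X i \<omega>)"
  shows "measure \<Omega> {\<omega> \<in> space \<Omega>. (\<Sum>i\<in>I \<omega>. X i \<omega>) = x}
    = pmf (bind_pmf (map_pmf card (pmf_of_set ind)) (iid_sum Q)) x"
proof -
  interpret prob_space \<Omega> by (rule prob)
  define B where "B A = {\<omega> \<in> space \<Omega>. I \<omega> = A \<and> (\<Sum>i\<in>A. X i \<omega>) = x}" for A
  define IA where "IA A = I -` {A} \<inter> space \<Omega>" for A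
  define SA where "SA A = {\<omega> \<in> space \<Omega>. (\<Sum>i\<in>A. X i \<omega>) = x}" for A
  have B: "B A = IA A \<inter> SA A" for A by (auto simp: B_def IA_def SA_def)
  have IA: "prob (IA A) = 1 / card ind" if "A \<in> ind" for A
  proof -
    have "prob (IA A) = measure (distr \<Omega> (count_space ind) I) {A}"
      unfolding IA_def using I_meas that by (subst measure_distr) auto
    then show ?thesis using that ind by (simp add: I_uniform measure_uniform_count_measure)
  qed
  have indep_set: "indep_set
       (sigma_sets (space \<Omega>) {I -` A \<inter> space \<Omega> | A. A \<in> sets (count_space ind)})
       (sigma_sets (space \<Omega>) {(\<lambda>\<omega>. \<lambda>i\<in>E. X i \<omega>) -` A \<inter> space \<Omega> | A. A \<in> sets (PiM E (\<lambda>_. count_space UNIV))})"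
    (is "indep_set ?\<I> ?\<X>")
    using I_X_indep by (simp add: indep_elements_def)
  have IA_in: "IA A \<in> ?\<I>" if "A \<in> ind" for A
    unfolding IA_def using that by (intro sigma_sets.Basic) auto
  have SA_in: "SA A \<in> ?\<X>" if "A \<in> ind" for A
  proof (rule sigma_sets.Basic)
    let ?P = "PiM E (\<lambda>_. count_space UNIV :: nat measure)"
    let ?V = "(\<lambda>g. \<Sum>i\<in>A. g i) -` {x} \<inter> space ?P"
    have "(\<lambda>g. \<Sum>i\<in>A. g i) \<in> measurable ?P (count_space UNIV)"
      using ind(3)[OF that] by (intro measurable_sum_count_space) auto
    then have "?V \<in> sets ?P" by (rule measurable_sets) simp
    moreover have "SA A = (\<lambda>\<omega>. \<lambda>i\<in>E. X i \<omega>) -` ?V \<inter> space \<Omega>"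
      using ind(3)[OF that] unfolding SA_def
      by (auto simp: space_PiM subset_iff intro!: sum.cong)
    ultimately show "SA A \<in> {(\<lambda>\<omega>. \<lambda>i\<in>E. X i \<omega>) -` A \<inter> space \<Omega> | A. A \<in> sets ?P}"
      by blast
  qed
  have B_ev: "B A \<in> events" if "A \<in> ind" for A
    unfolding B using IA_in[OF that] SA_in[OF that] indep_setD_ev1[OF indep_set] indep_setD_ev2[OF indep_set]
    by blast
  have "{\<omega> \<in> space \<Omega>. (\<Sum>i\<in>I \<omega>. X i \<omega>) = x} = (\<Union>A\<in>ind. B A)"
    using measurable_space[OF I_meas] by (auto simp: B_def)
  then have "prob {\<omega> \<in> space \<Omega>. (\<Sum>i\<in>I \<omega>. X i \<omega>) = x} = (\<Sum>A\<in>ind. prob (B A))"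
    using B_ev ind(1)
    by (simp only:) (intro finite_measure_finite_Union, auto simp: disjoint_family_on_def B_def)
  also have "\<dots> = (\<Sum>A\<in>ind. 1 / card ind * conv_power (pmf Q) (card A) x)"
  proof (intro sum.cong refl)
    fix A assume A: "A \<in> ind"
    have "prob (B A) = prob (IA A) * prob (SA A)"
      unfolding B by (rule indep_setD[OF indep_set IA_in[OF A] SA_in[OF A]])
    also have "prob (SA A) = conv_power (pmf Q) (card A) x"
      unfolding SA_def using ind(3)[OF A] E
      by (intro prob_iid_sum[OF X_indep X_law]) (auto intro: finite_subset)
    finally show "prob (B A) = 1 / card ind * conv_power (pmf Q) (card A) x"
      by (simp only: IA[OF A])
  qed
  also have "\<dots> = pmf (bind_pmf (map_pmf card (pmf_of_set ind)) (iid_sum Q)) x"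
    using ind by (simp add: bind_map_pmf pmf_bind_pmf_of_set pmf_iid_sum sum_divide_distrib)
  finally show ?thesis .
qed

section \<open>Random independent sets of a matroid\<close>

theorem corollary6p4:
  fixes n :: nat
    and ind :: "nat set set"
    and \<Omega> :: "'a measure"
    and I :: "'a \<Rightarrow> nat set"
    and X :: "nat \<Rightarrow> 'a \<Rightarrow> nat"
    and Q :: "nat pmf"
    and lam :: real
    and W :: "'a \<Rightarrow> nat"
  assumes matroid: "matroid {1..n} ind"
    and mason: "ultra_log_concave (\<lambda>k. real (num_indep ind k))"
    and prob: "prob_space \<Omega>"
    and I_meas: "I \<in> measurable \<Omega> (count_space ind)"
    and I_uniform: "distr \<Omega> (count_space ind) I = uniform_count_measure ind"
    and lam: "lam = (\<integral>\<omega>. real (card (I \<omega>)) \<partial>\<Omega>)"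
    and Q_zero: "pmf Q 0 = 0"
    and Q_log_concave: "log_concave Q"
    and Q_one: "pmf Q 1 > 0"
    and Q_two: "lam * (pmf Q 1)\<^sup>2 \<ge> 2 * pmf Q 2"
    and X_law: "\<And>i. i \<in> {1..n} \<Longrightarrow> distr \<Omega> (count_space UNIV) (X i) = measure_pmf Q"
    and X_indep: "prob_space.indep_vars \<Omega> (\<lambda>_. count_space UNIV) X {1..n}"
    and I_X_indep: "indep_elements \<Omega>
          (count_space ind) I
          (PiM {1..n} (\<lambda>_. count_space UNIV)) (\<lambda>\<omega>. \<lambda>i\<in>{1..n}. X i \<omega>)"
    and W: "\<And>\<omega>. \<omega> \<in> space \<Omega> \<Longrightarrow> W \<omega> = (\<Sum>i\<in>I \<omega>. X i \<omega>)"
  shows "discrete_entropy (\<lambda>x. measure \<Omega> {\<omega> \<in> space \<Omega>. W \<omega> = x})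
           \<le> discrete_entropy (compound_poisson Q lam)"
proof -
  have sub: "A \<subseteq> {1..n}" if "A \<in> ind" for A
    using matroid that by (simp add: matroid_def)
  have "finite ind" using sub by (intro finite_subset[of ind "Pow {1..n}"]) auto
  have "ind \<noteq> {}" using matroid by (auto simp: matroid_def)
  note ind = \<open>finite ind\<close> \<open>ind \<noteq> {}\<close>
  define N where "N = map_pmf card (pmf_of_set ind)"
  have "{\<omega> \<in> space \<Omega>. W \<omega> = x} = {\<omega> \<in> space \<Omega>. (\<Sum>i\<in>I \<omega>. X i \<omega>) = x}" for x
    using W by auto
  then have W_law: "(\<lambda>x. measure \<Omega> {\<omega> \<in> space \<Omega>. W \<omega> = x}) = pmf (bind_pmf N (iid_sum Q))"
    unfolding N_def
    using prob_random_weight[OF prob _ ind sub I_meas I_uniform X_law X_indep I_X_indep]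
    by (simp add: fun_eq_iff)
  have pmf_N: "pmf N k = real (num_indep ind k) / card ind" for k
  proof -
    have "pmf N k = measure (measure_pmf (pmf_of_set ind)) {A. card A = k}"
      by (simp add: N_def pmf_map vimage_def)
    also have "\<dots> = card (ind \<inter> {A. card A = k}) / card ind"
      using ind by (simp add: measure_pmf_of_set)
    also have "ind \<inter> {A. card A = k} = {A \<in> ind. card A = k}" by auto
    finally show ?thesis by (simp add: num_indep_def)
  qed
  have card_pos: "0 < real (card ind)" using ind by (simp add: card_gt_0_iff)
  have "ultra_log_concave (pmf N)"
    unfolding ultra_log_concave_def
  proof (intro conjI allI impI)
    show "interval_support (pmf N)"
      using mason card_pos by (simp add: ultra_log_concave_def interval_support_def pmf_N)
    fix k :: nat assume "1 \<le> k"
    then have "real (k + 1) * real (num_indep ind (k + 1)) * real (num_indep ind (k - 1))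
        \<le> real k * (real (num_indep ind k))\<^sup>2"
      using mason unfolding ultra_log_concave_def by blast
    from divide_right_mono[OF this, of "(real (card ind))\<^sup>2"]
    show "real (k + 1) * pmf N (k + 1) * pmf N (k - 1) \<le> real k * (pmf N k)\<^sup>2"
      by (simp add: pmf_N power_divide power2_eq_square)
  qed simp
  moreover have "finite (set_pmf N)" using ind by (simp add: N_def)
  moreover have "lam = measure_pmf.expectation N real"
  proof -
    have "lam = integral\<^sup>L (distr \<Omega> (count_space ind) I) (\<lambda>A. real (card A))"
      unfolding lam using I_meas by (intro integral_distr[symmetric]) auto
    also have "\<dots> = (\<Sum>A\<in>ind. real (card A)) / card ind"
      unfolding I_uniform uniform_count_measure_def using ind
      by (simp add: lebesgue_integral_point_measure_finite sum_divide_distrib)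
    also have "\<dots> = measure_pmf.expectation N real"
      using ind by (simp add: N_def integral_pmf_of_set)
    finally show ?thesis .
  qed
  ultimately show ?thesis
    unfolding W_law using compound_poisson_max_entropy[of N Q] Q_zero Q_log_concave Q_one Q_two
    by simp
qed

end
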